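(* Consider a multi-agent MDP $\langle I,S,A,P,r,\gamma,N\rangle$ with joint action space $A=A_1\times\cdots\times A_N$. For any dependent joint policy $\pi_{\mathrm{jt}}^{\mathrm{dep}}(\boldsymbol a|s)$, i.e. a joint policy that involves dependency among agents, there exists an independent joint policy $\pi_{\mathrm{jt}}^{\mathrm{ind}}$, i.e. one that does not involve dependency among agents and so has the form $\pi_{\mathrm{jt}}^{\mathrm{ind}}(\boldsymbol a|s)=\prod_{i=1}^N\pi_i(a_i|s)$, such that $$V_{\pi_{\mathrm{jt}}^{\mathrm{dep}}}(s)=V_{\pi_{\mathrm{jt}}^{\mathrm{ind}}}(s)\qquad\text{for any state } s\in S.$$
   Context: Multi-agent MDP: $N$ is the number of agents, $I=\{1,\dots,N\}$, $S$ is the set of states, $A_i$ is the action set of agent $i$, $A=A_1\times\cdots\times A_N$, $P(s'|s,\boldsymbol a)\in[0,1]$ is the transition probability, $r:S\times A\to\mathbb R$ is a shared bounded reward, and $\gamma\in[0,1)$ is the discount factor. Every agent observes the full state $s$. A joint policy assigns to each $s\in S$ a probability mass function $\pi_{\mathrm{jt}}(\cdot|s)$ on $A$. By the chain rule any joint policy can be written $\pi_{\mathrm{jt}}(\boldsymbol a|s)=\prod_{i=1}^N\pi_i(a_i|s,a_{<i})$ with $a_{<i}=(a_1,\dots,a_{i-1})$. It is independent if it factorizes as $\pi_{\mathrm{jt}}(\boldsymbol a|s)=\prod_{i=1}^N\pi_i(a_i|s)$, where each $\pi_i(\cdot|s)$ is a probability mass function on $A_i$, and it is dependent if it does not factorize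 in this way. The value function of a joint policy $\pi$ is the expected discounted return $V_\pi(s)=\mathbb E\big[\sum_{k=0}^\infty\gamma^k r(s_k,\boldsymbol a_k)\,\big|\,s_0=s\big]$, where $\boldsymbol a_k\sim\pi(\cdot|s_k)$ and $s_{k+1}\sim P(\cdot|s_k,\boldsymbol a_k)$. *)

theory Defs
  imports "HOL-Probability.Probability"
begin

section \<open>Multi-agent Markov decision processes\<close>

text \<open>
  Agents are \<open>1, \<dots>, N\<close>. All individual action sets \<open>A i\<close> live in one type \<open>'a\<close>, so that
  \<open>A\<^sub>1 \<times> \<dots> \<times> A\<^sub>N\<close> is the extensional product. State and action sets may be infinite; probability
  mass functions are \<open>pmf\<close>s whose support lies in the relevant set. For pmf-valued functions the
  first argument is the conditioning part: \<open>pmf (P s a) s'\<close> is \<open>P(s' | s, a)\<close> and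
  \<open>pmf (\<pi> s) a\<close> is \<open>\<pi>(a | s)\<close>.
\<close>

definition agents :: "nat \<Rightarrow> nat set" where
  "agents N = {1..N}"

definition joint_actions :: "nat \<Rightarrow> (nat \<Rightarrow> 'a set) \<Rightarrow> (nat \<Rightarrow> 'a) set" where
  "joint_actions N A = (\<Pi>\<^sub>E i\<in>agents N. A i)"

locale multi_agent_MDP =
  fixes N :: nat
    and S :: "'s set"
    and A :: "nat \<Rightarrow> 'a set"
    and P :: "'s \<Rightarrow> (nat \<Rightarrow> 'a) \<Rightarrow> 's pmf"
    and r :: "'s \<Rightarrow> (nat \<Rightarrow> 'a) \<Rightarrow> real"
    and \<gamma> :: real
  assumes transition: "\<And>s a. s \<in> S \<Longrightarrow> a \<in> joint_actions N A \<Longrightarrow> set_pmf (P s a) \<subseteq> S"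
    and reward_bounded: "\<exists>B. \<forall>s\<in>S. \<forall>a\<in>joint_actions N A. \<bar>r s a\<bar> \<le> B"
    and discount: "0 \<le> \<gamma>" "\<gamma> < 1"

definition joint_policy ::
    "nat \<Rightarrow> 's set \<Rightarrow> (nat \<Rightarrow> 'a set) \<Rightarrow> ('s \<Rightarrow> (nat \<Rightarrow> 'a) pmf) \<Rightarrow> bool" where
  "joint_policy N S A \<pi> \<longleftrightarrow> (\<forall>s\<in>S. set_pmf (\<pi> s) \<subseteq> joint_actions N A)"

definition individual_policy :: "'s set \<Rightarrow> 'a set \<Rightarrow> ('s \<Rightarrow> 'a pmf) \<Rightarrow> bool" where
  "individual_policy S B p \<longleftrightarrow> (\<forall>s\<in>S. set_pmf (p s) \<subseteq> B)"

definition independent_policy ::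
    "nat \<Rightarrow> 's set \<Rightarrow> (nat \<Rightarrow> 'a set) \<Rightarrow> ('s \<Rightarrow> (nat \<Rightarrow> 'a) pmf) \<Rightarrow> bool" where
  "independent_policy N S A \<pi> \<longleftrightarrow>
     joint_policy N S A \<pi> \<and>
     (\<exists>p :: nat \<Rightarrow> 's \<Rightarrow> 'a pmf.
        (\<forall>i\<in>agents N. individual_policy S (A i) (p i)) \<and>
        (\<forall>s\<in>S. \<forall>a\<in>joint_actions N A. pmf (\<pi> s) a = (\<Prod>i\<in>agents N. pmf (p i s) (a i))))"

definition dependent_policy ::
    "nat \<Rightarrow> 's set \<Rightarrow> (nat \<Rightarrow> 'a set) \<Rightarrow> ('s \<Rightarrow> (nat \<Rightarrow> 'a) pmf) \<Rightarrow> bool" where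
  "dependent_policy N S A \<pi> \<longleftrightarrow> joint_policy N S A \<pi> \<and> \<not> independent_policy N S A \<pi>"

section \<open>The trajectory measure and the value function\<close>

text \<open>
  A trajectory is the sequence of pairs \<open>(s\<^sub>k, a\<^sub>k)\<close>. Its law is obtained by the Ionescu-Tulcea
  construction from \<open>step_kernel P \<pi> s0 k \<omega>\<close>, the conditional law of the \<open>k\<close>-th pair given the
  initial segment \<open>\<omega>\<close>. All coordinate spaces are discrete.
\<close>

definition step_pmf ::
    "('s \<Rightarrow> (nat \<Rightarrow> 'a) \<Rightarrow> 's pmf) \<Rightarrow> ('s \<Rightarrow> (nat \<Rightarrow> 'a) pmf) \<Rightarrow> 's \<Rightarrow>
     nat \<Rightarrow> (nat \<Rightarrow> 's \<times> (nat \<Rightarrow> 'a)) \<Rightarrow> ('s \<times> (nat \<Rightarrow> 'a)) pmf" where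
  "step_pmf P \<pi> s0 k \<omega> =
     bind_pmf (case k of 0 \<Rightarrow> return_pmf s0 | Suc j \<Rightarrow> P (fst (\<omega> j)) (snd (\<omega> j)))
       (\<lambda>s. map_pmf (Pair s) (\<pi> s))"

definition step_kernel ::
    "('s \<Rightarrow> (nat \<Rightarrow> 'a) \<Rightarrow> 's pmf) \<Rightarrow> ('s \<Rightarrow> (nat \<Rightarrow> 'a) pmf) \<Rightarrow> 's \<Rightarrow>
     nat \<Rightarrow> (nat \<Rightarrow> 's \<times> (nat \<Rightarrow> 'a)) \<Rightarrow> ('s \<times> (nat \<Rightarrow> 'a)) measure" where
  "step_kernel P \<pi> s0 k \<omega> = measure_pmf (step_pmf P \<pi> s0 k \<omega>)"

lemma Ionescu_Tulcea_step_kernel: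
  "Ionescu_Tulcea (step_kernel P \<pi> s0) (\<lambda>_. count_space UNIV)"
proof (rule Ionescu_Tulcea.intro)
  fix k
  show "step_kernel P \<pi> s0 k \<in>
      measurable (PiM {0..<k} (\<lambda>_. count_space UNIV)) (subprob_algebra (count_space UNIV))"
  proof (cases k)
    case 0
    then show ?thesis
      unfolding step_kernel_def step_pmf_def
      by (auto intro!: measurable_const measure_pmf_in_subprob_algebra)
  next
    case (Suc j)
    let ?K = "\<lambda>x. measure_pmf (bind_pmf (P (fst x) (snd x)) (\<lambda>s. map_pmf (Pair s) (\<pi> s)))"
    have "?K \<in> measurable (count_space UNIV) (subprob_algebra (count_space UNIV))"
      by (auto intro!: measure_pmf_in_subprob_algebra)
    moreover have "(\<lambda>\<omega>. \<omega> j) \<in> measurable (PiM {0..<k} (\<lambda>_. count_space UNIV)) (count_space UNIV)"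
      using Suc by (intro measurable_component_singleton) auto
    ultimately have "(\<lambda>\<omega>. ?K (\<omega> j)) \<in>
        measurable (PiM {0..<k} (\<lambda>_. count_space UNIV)) (subprob_algebra (count_space UNIV))"
      using measurable_compose by blast
    then show ?thesis
      using Suc unfolding step_kernel_def step_pmf_def by simp
  qed
next
  show "prob_space (step_kernel P \<pi> s0 k \<omega>)" for k \<omega>
    unfolding step_kernel_def by (rule measure_pmf.prob_space_axioms)
qed

definition trajectory_measure ::
    "('s \<Rightarrow> (nat \<Rightarrow> 'a) \<Rightarrow> 's pmf) \<Rightarrow> ('s \<Rightarrow> (nat \<Rightarrow> 'a) pmf) \<Rightarrow> 's \<Rightarrow>
     (nat \<Rightarrow> 's \<times> (nat \<Rightarrow> 'a)) measure" where
  "trajectory_measure P \<pi> s0 =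
     projective_family.lim UNIV
       (Ionescu_Tulcea.CI (step_kernel P \<pi> s0) (\<lambda>_. count_space UNIV)) (\<lambda>_. count_space UNIV)"

definition value_function ::
    "('s \<Rightarrow> (nat \<Rightarrow> 'a) \<Rightarrow> 's pmf) \<Rightarrow> ('s \<Rightarrow> (nat \<Rightarrow> 'a) \<Rightarrow> real) \<Rightarrow> real \<Rightarrow>
     ('s \<Rightarrow> (nat \<Rightarrow> 'a) pmf) \<Rightarrow> 's \<Rightarrow> real" where
  "value_function P r \<gamma> \<pi> s =
     (\<integral>\<omega>. (\<Sum>k. \<gamma> ^ k * r (fst (\<omega> k)) (snd (\<omega> k))) \<partial>trajectory_measure P \<pi> s)"

text \<open>
  The finite-dimensional marginals of the trajectory measure are those of the Markov chain
  generated by the step kernels.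
\<close>

lemma distr_trajectory_measure:
  assumes "finite J"
  shows "distr (trajectory_measure P \<pi> s0) (PiM J (\<lambda>_. count_space UNIV)) (\<lambda>\<omega>. restrict \<omega> J) =
    Ionescu_Tulcea.CI (step_kernel P \<pi> s0) (\<lambda>_. count_space UNIV) J"
  unfolding trajectory_measure_def
  by (rule Ionescu_Tulcea.distr_lim[OF Ionescu_Tulcea_step_kernel assms])

lemma sets_trajectory_measure:
  "sets (trajectory_measure P \<pi> s0) = sets (PiM UNIV (\<lambda>_. count_space UNIV))"
proof -
  interpret IT: Ionescu_Tulcea "step_kernel P \<pi> s0" "\<lambda>_. count_space UNIV"
    by (rule Ionescu_Tulcea_step_kernel)
  show ?thesis
    unfolding trajectory_measure_def by (rule IT.PF.sets_lim)
qed

lemma prob_space_trajectory_measure: "prob_space (trajectory_measure P \<pi> s0)"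
proof -
  interpret IT: Ionescu_Tulcea "step_kernel P \<pi> s0" "\<lambda>_. count_space UNIV"
    by (rule Ionescu_Tulcea_step_kernel)
  have "prob_space (distr (trajectory_measure P \<pi> s0) (PiM {} (\<lambda>_. count_space UNIV)) (\<lambda>\<omega>. restrict \<omega> {}))"
    by (subst distr_trajectory_measure) (auto intro: IT.PF.prob_space_P)
  moreover have "(\<lambda>\<omega>. restrict \<omega> {}) \<in>
      measurable (trajectory_measure P \<pi> s0) (PiM {} (\<lambda>_. count_space UNIV))"
    by (auto simp: measurable_cong_sets[OF sets_trajectory_measure refl])
  ultimately show ?thesis
    using prob_space_distrD by blast
qed

end

theory Submission
  imports Defs
begin

text \<open>
  Let \<open>V\<close> be the value function of the given policy \<open>\<pi>\<close> and \<open>Q(s, a) = r(s, a) + \<gamma> E[V(s')]\<close>. By the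
  Bellman equation \<open>V(s)\<close> is the mean of \<open>Q(s, \<cdot>)\<close> under \<open>\<pi>(\<cdot>|s)\<close>, so it lies between the values of
  \<open>Q(s, \<cdot>)\<close> at two joint actions. Some product distribution interpolating between these two actions
  has the same mean \<open>V(s)\<close>. Choosing one for every state gives an independent policy whose Bellman
  equation is solved by \<open>V\<close>; as this equation has only one bounded solution, \<open>V\<close> is also its value
  function.
\<close>

section \<open>Expectations of bounded functions under discrete distributions\<close>

lemma integrable_pmf_bounded:
  fixes f :: "'b \<Rightarrow> real"
  assumes "\<And>x. x \<in> set_pmf p \<Longrightarrow> \<bar>f x\<bar> \<le> B"
  shows "integrable (measure_pmf p) f"
  using assms by (intro measure_pmf.integrable_const_bound[where B = B]) (auto simp: AE_measure_pmf_iff)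

lemma abs_expectation_pmf_le:
  fixes f :: "'b \<Rightarrow> real"
  assumes "\<And>x. x \<in> set_pmf p \<Longrightarrow> \<bar>f x\<bar> \<le> B"
  shows "\<bar>measure_pmf.expectation p f\<bar> \<le> B"
proof -
  have int: "integrable (measure_pmf p) f"
    using assms by (rule integrable_pmf_bounded)
  have "f x \<le> B" "- B \<le> f x" if "x \<in> set_pmf p" for x
    using assms[OF that] by linarith+
  then have "measure_pmf.expectation p f \<le> B" "- B \<le> measure_pmf.expectation p f"
    by (intro measure_pmf.integral_le_const measure_pmf.integral_ge_const int;
        simp add: AE_measure_pmf_iff)+
  then show ?thesis
    by linarith
qed

lemma integral_pmf_cong:
  fixes f g :: "'b \<Rightarrow> real"
  assumes "\<And>x. x \<in> set_pmf p \<Longrightarrow> f x = g x"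
  shows "measure_pmf.expectation p f = measure_pmf.expectation p g"
  using assms by (intro integral_cong_AE) (auto simp: AE_measure_pmf_iff)

section \<open>Tower rule and comparison of a function with its mean\<close>

lemma expectation_bind_pmf_bounded:
  fixes h :: "'b \<Rightarrow> real"
  assumes "\<And>y. y \<in> set_pmf (bind_pmf p q) \<Longrightarrow> \<bar>h y\<bar> \<le> B"
  shows "measure_pmf.expectation (bind_pmf p q) h =
    measure_pmf.expectation p (\<lambda>x. measure_pmf.expectation (q x) h)"
proof -
  \<comment> \<open>\<open>integral_bind\<close> asks for a bound on the whole type, but
    \<open>h\<close> is controlled only on the support. Setting it to 0 elsewhere changes no
    expectation, and \<open>max B 0\<close> covers the added zeros.\<close>
  define g where "g y = (if y \<in> set_pmf (bind_pmf p q) then h y else 0)" for y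
  have g: "\<bar>g y\<bar> \<le> max B 0" for y
    using assms[of y] by (cases "y \<in> set_pmf (bind_pmf p q)") (simp_all add: g_def del: set_bind_pmf)
  have "measure_pmf.expectation (bind_pmf p q) h = measure_pmf.expectation (bind_pmf p q) g"
    by (intro integral_pmf_cong) (simp add: g_def)
  also have "\<dots> = measure_pmf.expectation p (\<lambda>x. measure_pmf.expectation (q x) g)"
    unfolding measure_pmf_bind
    by (rule integral_bind[where K = "count_space UNIV" and B = "max B 0" and B' = 1])
      (auto simp: g measure_pmf.finite_measure_axioms measure_pmf.emeasure_space_1[simplified]
        intro!: measure_pmf_in_subprob_algebra)
  also have "\<dots> = measure_pmf.expectation p (\<lambda>x. measure_pmf.expectation (q x) h)"
    by (intro integral_pmf_cong) (auto simp: g_def)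
  finally show ?thesis .
qed

text \<open>By strict monotonicity of the expectation, a function below its mean on the whole
  support would have a mean below itself. This avoids taking a maximum, which need not exist on an
  infinite support.\<close>

lemma exists_ge_expectation_pmf:
  fixes f :: "'b \<Rightarrow> real"
  assumes bounded: "\<And>x. x \<in> set_pmf p \<Longrightarrow> \<bar>f x\<bar> \<le> B"
  shows "\<exists>x\<in>set_pmf p. measure_pmf.expectation p f \<le> f x"
proof (rule ccontr)
  assume "\<not> ?thesis"
  then have "AE x in measure_pmf p. f x < measure_pmf.expectation p f"
    by (simp add: AE_measure_pmf_iff not_le)
  with integrable_pmf_bounded[OF bounded]
  have "measure_pmf.expectation p f < measure_pmf.expectation p f"
    by (rule measure_pmf.expectation_less)
  then show False ..
qed

lemma exists_le_expectation_pmf: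
  fixes f :: "'b \<Rightarrow> real"
  assumes "\<And>x. x \<in> set_pmf p \<Longrightarrow> \<bar>f x\<bar> \<le> B"
  shows "\<exists>x\<in>set_pmf p. f x \<le> measure_pmf.expectation p f"
  using exists_ge_expectation_pmf[of p "\<lambda>x. - f x" B] assms by auto

text \<open>
  Mixing \<open>a\<close> and \<open>b\<close> independently in every coordinate with the same weight \<open>t\<close> gives an
  expectation that is a polynomial in \<open>t\<close>, so the intermediate value theorem applies.
\<close>
lemma exists_Pi_pmf_expectation_eq:
  fixes f :: "('i \<Rightarrow> 'b) \<Rightarrow> real"
  assumes I: "finite I" and a: "a \<in> (\<Pi>\<^sub>E i\<in>I. A i)" and b: "b \<in> (\<Pi>\<^sub>E i\<in>I. A i)"
    and le: "f a \<le> c" "c \<le> f b"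
  shows "\<exists>p. (\<forall>i\<in>I. set_pmf (p i) \<subseteq> A i) \<and>
    measure_pmf.expectation (Pi_pmf I undefined p) f = c"
proof -
  define p where "p t i = map_pmf (\<lambda>u. if u then b i else a i) (bernoulli_pmf t)" for t i
  \<comment> \<open>\<open>X\<close> is finite and carries all the mixtures \<open>p t\<close>, even
    if the sets \<open>A i\<close> are infinite, so the expectations become finite sums.\<close>
  define X where "X = PiE_dflt I undefined (\<lambda>i. {a i, b i})"
  \<comment> \<open>The polynomial makes sense for every real \<open>t\<close>, which makes
    continuity immediate; it equals the expectation for \<open>t\<close> in [0,1]. The two
    indicators add up correctly when \<open>a i = b i\<close>.\<close>
  define F where "F t = (\<Sum>x\<in>X. f x *
    (\<Prod>i\<in>I. t * of_bool (b i = x i) + (1 - t) * of_bool (a i = x i)))" for t :: real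
  have X: "finite X"
    unfolding X_def using I by auto
  have set_p: "set_pmf (p t i) \<subseteq> {a i, b i}" for t i
    by (auto simp: p_def)
  have pmf_p: "pmf (p t i) y = t * of_bool (b i = y) + (1 - t) * of_bool (a i = y)"
    if "0 \<le> t" "t \<le> 1" for t i y
    using that by (simp add: p_def map_pmf_def pmf_bind indicator_def)
  have expectation: "measure_pmf.expectation (Pi_pmf I undefined (p t)) f = F t"
    if t: "0 \<le> t" "t \<le> 1" for t
  proof -
    have "set_pmf (Pi_pmf I undefined (p t)) \<subseteq> X"
      using set_p[of t] unfolding X_def set_Pi_pmf[OF I] PiE_dflt_def o_apply by blast
    then have "measure_pmf.expectation (Pi_pmf I undefined (p t)) f =
        (\<Sum>x\<in>X. f x * pmf (Pi_pmf I undefined (p t)) x)"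
      using X by (intro integral_measure_pmf_real) auto
    also have "\<dots> = F t"
      unfolding F_def
    proof (intro sum.cong refl)
      fix x assume "x \<in> X"
      then show "f x * pmf (Pi_pmf I undefined (p t)) x =
          f x * (\<Prod>i\<in>I. t * of_bool (b i = x i) + (1 - t) * of_bool (a i = x i))"
        using I by (simp add: pmf_Pi' X_def PiE_dflt_def pmf_p[OF t])
    qed
    finally show ?thesis .
  qed
  \<comment> \<open>At \<open>t = 0\<close> and \<open>t = 1\<close> the product is a point mass at
    \<open>a\<close> or \<open>b\<close> with its values off \<open>I\<close> reset to
    \<open>undefined\<close>; extensional functions are unchanged by this.\<close>
  have endpoint: "(\<lambda>i. if i \<in> I then z i else undefined) = z" if "z \<in> (\<Pi>\<^sub>E i\<in>I. A i)" for z
    using PiE_restrict[OF that] by (simp only: restrict_def)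
  have "p 0 = (\<lambda>i. return_pmf (a i))" "p 1 = (\<lambda>i. return_pmf (b i))"
    by (auto simp: p_def fun_eq_iff intro!: pmf_eqI simp: pmf_p[unfolded p_def] indicator_def)
  then have "F 0 = f a" "F 1 = f b"
    using expectation[of 0] expectation[of 1] endpoint[OF a] endpoint[OF b] I by simp_all
  moreover have "continuous_on {0..1} F"
    unfolding F_def by (intro continuous_intros)
  ultimately obtain t where t: "0 \<le> t" "t \<le> 1" "F t = c"
    using IVT'[of F 0 c 1] le by auto
  moreover have "set_pmf (p t i) \<subseteq> A i" if "i \<in> I" for i
    using set_p[of t i] PiE_mem[OF a that] PiE_mem[OF b that] by blast
  ultimately show ?thesis
    using expectation[of t] by blast
qed

section \<open>Marginals of the trajectory measure\<close>

primrec chain_pmf :: "('s \<Rightarrow> 's pmf) \<Rightarrow> nat \<Rightarrow> 's \<Rightarrow> 's pmf" where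
  "chain_pmf K 0 s = return_pmf s"
| "chain_pmf K (Suc k) s = bind_pmf (chain_pmf K k s) K"

text \<open>\<open>chain_pmf\<close> appends steps at the end, as a trajectory grows; the Bellman
  equation conditions on the first step, so it needs the iterate unrolled from the front.\<close>

lemma chain_pmf_Suc_left: "chain_pmf K (Suc k) s = bind_pmf (K s) (chain_pmf K k)"
proof (induction k)
  case 0
  show ?case
    by (simp add: bind_return_pmf bind_return_pmf')
next
  case (Suc k)
  have "chain_pmf K (Suc (Suc k)) s = bind_pmf (chain_pmf K (Suc k) s) K"
    by simp
  also have "\<dots> = bind_pmf (K s) (\<lambda>x. chain_pmf K (Suc k) x)"
    unfolding Suc.IH by (simp add: bind_assoc_pmf)
  finally show ?case
    by simp
qed

lemma set_chain_pmf_subset: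
  assumes "\<And>s. s \<in> S \<Longrightarrow> set_pmf (K s) \<subseteq> S" "s \<in> S"
  shows "set_pmf (chain_pmf K k s) \<subseteq> S"
  using assms by (induction k) auto

abbreviation state_kernel ::
    "('s \<Rightarrow> (nat \<Rightarrow> 'a) \<Rightarrow> 's pmf) \<Rightarrow> ('s \<Rightarrow> (nat \<Rightarrow> 'a) pmf) \<Rightarrow> 's \<Rightarrow> 's pmf" where
  "state_kernel P \<pi> s \<equiv> bind_pmf (\<pi> s) (P s)"

abbreviation pair_marginal ::
    "('s \<Rightarrow> (nat \<Rightarrow> 'a) \<Rightarrow> 's pmf) \<Rightarrow> ('s \<Rightarrow> (nat \<Rightarrow> 'a) pmf) \<Rightarrow> nat \<Rightarrow> 's \<Rightarrow>
     ('s \<times> (nat \<Rightarrow> 'a)) pmf" where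
  "pair_marginal P \<pi> k s \<equiv>
     bind_pmf (chain_pmf (state_kernel P \<pi>) k s) (\<lambda>s. map_pmf (Pair s) (\<pi> s))"

lemma measurable_trajectory_coordinate:
  "(\<lambda>\<omega>. \<omega> k) \<in> measurable (trajectory_measure P \<pi> s) (count_space UNIV)"
  by (simp add: measurable_cong_sets[OF sets_trajectory_measure refl]
      measurable_component_singleton[where I = UNIV and M = "\<lambda>_. count_space UNIV"])

section \<open>Single-coordinate marginals in a general Ionescu-Tulcea construction\<close>

context Ionescu_Tulcea
begin

text \<open>The law of the first \<open>k\<close> coordinates: \<open>C 0 k\<close> extends the
  empty history, and \<open>\<lambda>x. undefined\<close> is the only point of the product over the
  empty index set.\<close>

abbreviation initial_law :: "nat \<Rightarrow> (nat \<Rightarrow> 'a) measure" where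
  "initial_law k \<equiv> C 0 k (\<lambda>x. undefined)"

lemma undefined_in_space_PiM: "(\<lambda>x. undefined) \<in> space (PiM {0..<0} M)"
  by (simp add: space_PiM)

lemma measurable_coordinate: "(\<lambda>\<omega>. \<omega> k) \<in> measurable (PiM {0..<Suc k} M) (M k)"
  by (rule measurable_component_singleton) simp

lemma measurable_initial_law: "measurable (initial_law k) N = measurable (PiM {0..<k} M) N"
  using sets_C[OF undefined_in_space_PiM] by (intro measurable_cong_sets) simp_all

lemma space_initial_law: "space (initial_law k) = space (PiM {0..<k} M)"
  using space_C[OF undefined_in_space_PiM] by simp

lemma initial_law_not_empty: "space (initial_law k) \<noteq> {}"
  using prob_space_C[OF undefined_in_space_PiM] by (rule prob_space.not_empty)

text \<open>\<open>eP k \<omega>\<close> is the image of \<open>P k \<omega>\<close> under writing a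
  value into coordinate \<open>k\<close> of \<open>\<omega>\<close>; reading that coordinate again
  undoes the writing.\<close>

lemma distr_eP_coordinate:
  assumes \<omega>: "\<omega> \<in> space (PiM {0..<k} M)"
  shows "distr (eP k \<omega>) (M k) (\<lambda>\<omega>. \<omega> k) = P k \<omega>"
proof -
  have "fun_upd \<omega> k \<in> measurable (P k \<omega>) (PiM {0..<Suc k} M)"
    using \<omega> by (intro measurable_fun_upd[where J = "{0..<k}"])
      (simp_all add: atLeast0_lessThan_Suc measurable_cong_sets[OF sets_P[OF \<omega>] refl])
  from distr_distr[OF measurable_coordinate this] show ?thesis
    unfolding eP_def by (simp add: comp_def distr_id2 sets_P[OF \<omega>])
qed

lemma distr_initial_law_coordinate:
  "distr (initial_law (Suc k)) (M k) (\<lambda>\<omega>. \<omega> k) = initial_law k \<bind> P k"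
proof -
  have "distr (initial_law (Suc k)) (M k) (\<lambda>\<omega>. \<omega> k) =
      initial_law k \<bind> (\<lambda>\<omega>. distr (eP k \<omega>) (M k) (\<lambda>\<omega>. \<omega> k))"
    unfolding C.simps add_0
    by (rule distr_bind[OF _ initial_law_not_empty measurable_coordinate])
      (unfold measurable_initial_law, rule measurable_eP)
  also have "\<dots> = initial_law k \<bind> P k"
    by (intro bind_cong refl distr_eP_coordinate) (simp only: space_initial_law)
  finally show ?thesis .
qed

lemma distr_lim_coordinate: "distr PF.lim (M k) (\<lambda>\<omega>. \<omega> k) = initial_law k \<bind> P k"
proof -
  \<comment> \<open>\<open>CI {k}\<close> is computed from the shortest initial segment containing
    coordinate \<open>k\<close>, which has length \<open>Suc k\<close>.\<close>
  have up_to: "up_to {k} = Suc k"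
    by (intro antisym) (simp_all add: up_to_iff Suc_le_eq up_to_less)
  have coordinate: "(\<lambda>\<omega>. \<omega> k) \<in> measurable (PiM {k} M) (M k)"
    by (rule measurable_component_singleton) simp
  \<comment> \<open>Reading coordinate \<open>k\<close> factors through the restriction to
    \<open>{k}\<close>, so the limit and the initial law can be compared on their \<open>{k}\<close>
    marginals, where \<open>distr_lim\<close> applies.\<close>
  have eq: "(\<lambda>\<omega>. \<omega> k) \<circ> (\<lambda>\<omega>. restrict \<omega> {k}) = (\<lambda>\<omega>. \<omega> k)"
    by (simp add: comp_def)
  have "(\<lambda>\<omega>. restrict \<omega> {k}) \<in> measurable PF.lim (PiM {k} M)"
    unfolding measurable_cong_sets[OF PF.sets_lim refl] by (rule measurable_restrict_subset) simp
  note distr_distr[OF coordinate this, unfolded eq]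
  moreover have "(\<lambda>\<omega>. restrict \<omega> {k}) \<in> measurable (initial_law (Suc k)) (PiM {k} M)"
    unfolding measurable_initial_law by (rule measurable_restrict_subset) simp
  note distr_distr[OF coordinate this, unfolded eq]
  ultimately show ?thesis
    using distr_lim[of "{k}"] by (simp add: CI_def up_to distr_initial_law_coordinate del: C.simps)
qed

end

text \<open>Markov property: the kernel for pair \<open>Suc j\<close> looks at the history only
  through pair \<open>j\<close>. Its average over histories therefore depends only on the law of
  pair \<open>j\<close>, which the induction hypothesis supplies.\<close>

lemma distr_trajectory_coordinate:
  "distr (trajectory_measure P \<pi> s) (count_space UNIV) (\<lambda>\<omega>. \<omega> k) =
    measure_pmf (pair_marginal P \<pi> k s)"
proof -
  note IT = Ionescu_Tulcea_step_kernel[of P \<pi> s]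
  let ?C = "Ionescu_Tulcea.C (step_kernel P \<pi> s) (\<lambda>_. count_space UNIV) 0"
  let ?u = "\<lambda>_. undefined"
  have "?C k ?u \<bind> step_kernel P \<pi> s k = measure_pmf (pair_marginal P \<pi> k s)"
  proof (induction k)
    case 0
    have "?C 0 ?u \<bind> step_kernel P \<pi> s 0 = step_kernel P \<pi> s 0 ?u"
      unfolding Ionescu_Tulcea.C.simps[OF IT]
      by (rule bind_return[OF Ionescu_Tulcea.P[OF IT] Ionescu_Tulcea.undefined_in_space_PiM[OF IT]])
    also have "\<dots> = measure_pmf (pair_marginal P \<pi> 0 s)"
      by (simp add: step_kernel_def step_pmf_def bind_return_pmf)
    finally show ?case .
  next
    case (Suc j)
    let ?K = "\<lambda>x. bind_pmf (P (fst x) (snd x)) (\<lambda>s. map_pmf (Pair s) (\<pi> s))"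
    have kernel: "step_kernel P \<pi> s (Suc j) = (\<lambda>\<omega>. measure_pmf (?K (\<omega> j)))"
      by (simp add: fun_eq_iff step_kernel_def step_pmf_def)
    have "(\<lambda>\<omega>. \<omega> j) \<in> measurable (?C (Suc j) ?u) (count_space UNIV)"
      unfolding Ionescu_Tulcea.measurable_initial_law[OF IT]
      by (rule Ionescu_Tulcea.measurable_coordinate[OF IT])
    \<comment> \<open>Averaging a kernel composed with a coordinate is averaging it over the image
      law of that coordinate.\<close>
    from bind_distr[OF this measurable_measure_pmf Ionescu_Tulcea.initial_law_not_empty[OF IT], of ?K]
    have "?C (Suc j) ?u \<bind> step_kernel P \<pi> s (Suc j) =
        measure_pmf (pair_marginal P \<pi> j s) \<bind> (\<lambda>x. measure_pmf (?K x))"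
      unfolding Ionescu_Tulcea.distr_initial_law_coordinate[OF IT] Suc.IH kernel by (rule sym)
    also have "\<dots> = measure_pmf (pair_marginal P \<pi> (Suc j) s)"
      unfolding measure_pmf_bind[symmetric] by (simp add: bind_assoc_pmf bind_map_pmf)
    finally show ?case .
  qed
  then show ?thesis
    unfolding trajectory_measure_def Ionescu_Tulcea.distr_lim_coordinate[OF IT] .
qed

section \<open>The Bellman equation\<close>

context multi_agent_MDP
begin

definition expected_reward :: "('s \<Rightarrow> (nat \<Rightarrow> 'a) pmf) \<Rightarrow> 's \<Rightarrow> real" where
  "expected_reward \<pi> s = measure_pmf.expectation (\<pi> s) (r s)"

definition action_value :: "('s \<Rightarrow> real) \<Rightarrow> 's \<Rightarrow> (nat \<Rightarrow> 'a) \<Rightarrow> real" where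
  "action_value V s a = r s a + \<gamma> * measure_pmf.expectation (P s a) V"

definition reward_bound :: real where
  "reward_bound = (SOME B. \<forall>s\<in>S. \<forall>a\<in>joint_actions N A. \<bar>r s a\<bar> \<le> B)"

lemma abs_reward_le: "s \<in> S \<Longrightarrow> a \<in> joint_actions N A \<Longrightarrow> \<bar>r s a\<bar> \<le> reward_bound"
  using someI_ex[OF reward_bounded] unfolding reward_bound_def by blast

lemma finite_agents: "finite (agents N)"
  by (simp add: agents_def)

lemma set_policy:
  "joint_policy N S A \<pi> \<Longrightarrow> s \<in> S \<Longrightarrow> a \<in> set_pmf (\<pi> s) \<Longrightarrow> a \<in> joint_actions N A"
  by (auto simp: joint_policy_def)

lemma set_state_kernel:
  "joint_policy N S A \<pi> \<Longrightarrow> s \<in> S \<Longrightarrow> set_pmf (state_kernel P \<pi> s) \<subseteq> S"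
  by (simp add: UN_least transition set_policy)

lemma set_chain:
  "joint_policy N S A \<pi> \<Longrightarrow> s \<in> S \<Longrightarrow> x \<in> set_pmf (chain_pmf (state_kernel P \<pi>) k s) \<Longrightarrow> x \<in> S"
  using set_chain_pmf_subset[of S "state_kernel P \<pi>" s k] set_state_kernel by blast

lemma abs_expected_reward_le:
  "joint_policy N S A \<pi> \<Longrightarrow> s \<in> S \<Longrightarrow> \<bar>expected_reward \<pi> s\<bar> \<le> reward_bound"
  unfolding expected_reward_def by (intro abs_expectation_pmf_le abs_reward_le set_policy)

section \<open>Discounted sums and their expectations\<close>

lemma summable_discounted: "summable (\<lambda>k. \<gamma> ^ k * B)"
  using discount by (intro summable_mult2 summable_geometric) simp

lemma abs_discounted: "\<bar>\<gamma> ^ k * x\<bar> = \<gamma> ^ k * \<bar>x\<bar>"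
  using discount by (simp add: abs_mult)

lemma summable_discounted_bounded:
  assumes "\<And>k. \<bar>x k\<bar> \<le> B"
  shows "summable (\<lambda>k. \<gamma> ^ k * x k)"
proof (rule summable_comparison_test)
  show "\<exists>n. \<forall>k\<ge>n. norm (\<gamma> ^ k * x k) \<le> \<gamma> ^ k * B"
    using assms by (simp add: abs_discounted discount mult_left_mono)
qed (rule summable_discounted)

text \<open>The geometric series with terms \<open>\<gamma> ^ k * B\<close> dominates, so sum and
  integral commute. The bound is needed only almost everywhere because rewards are bounded only on
  legal pairs; countably many null sets are discarded together. It is used both for trajectories and
  for the next state.\<close>

lemma integral_suminf_discounted:
  assumes "prob_space M" and f: "\<And>k. f k \<in> borel_measurable M"
    and bounded: "\<And>k. AE \<omega> in M. \<bar>f k \<omega>\<bar> \<le> B"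
  shows "(\<integral>\<omega>. (\<Sum>k. \<gamma> ^ k * f k \<omega>) \<partial>M) = (\<Sum>k. \<gamma> ^ k * (\<integral>\<omega>. f k \<omega> \<partial>M))"
proof -
  interpret prob_space M by fact
  have int: "integrable M (f k)" for k
    using bounded[of k] f[of k] by (intro integrable_const_bound) (simp_all only: real_norm_def)
  have "(\<integral>\<omega>. (\<Sum>k. \<gamma> ^ k * f k \<omega>) \<partial>M) = (\<Sum>k. \<integral>\<omega>. \<gamma> ^ k * f k \<omega> \<partial>M)"
  proof (rule integral_suminf)
    show "integrable M (\<lambda>\<omega>. \<gamma> ^ k * f k \<omega>)" for k
      using int by simp
    have "AE \<omega> in M. \<forall>k. \<bar>f k \<omega>\<bar> \<le> B"
      unfolding AE_all_countable using bounded by blast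
    then show "AE \<omega> in M. summable (\<lambda>k. norm (\<gamma> ^ k * f k \<omega>))"
    proof eventually_elim
      case (elim \<omega>)
      then show ?case
        unfolding real_norm_def abs_discounted
        by (intro summable_discounted_bounded[where B = B]) simp
    qed
    have "\<bar>\<integral>\<omega>. \<bar>f k \<omega>\<bar> \<partial>M\<bar> \<le> B" for k
      using integral_le_const[OF integrable_abs[OF int] bounded, of k] by simp
    then show "summable (\<lambda>k. \<integral>\<omega>. norm (\<gamma> ^ k * f k \<omega>) \<partial>M)"
      unfolding real_norm_def abs_discounted integral_mult_right_zero
      by (rule summable_discounted_bounded)
  qed
  then show ?thesis
    by simp
qed

text \<open>After exchanging sum and integral, the \<open>k\<close>-th term sees only the
  \<open>k\<close>-th pair, whose law is known. The later arguments work with this series and the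
  state chain instead of the trajectory measure.\<close>

lemma value_function_eq_suminf:
  assumes \<pi>: "joint_policy N S A \<pi>" and s: "s \<in> S"
  shows "value_function P r \<gamma> \<pi> s =
    (\<Sum>k. \<gamma> ^ k * measure_pmf.expectation (chain_pmf (state_kernel P \<pi>) k s) (expected_reward \<pi>))"
proof -
  let ?T = "trajectory_measure P \<pi> s"
  let ?f = "\<lambda>x. r (fst x) (snd x)"
  have bound: "\<bar>?f x\<bar> \<le> reward_bound" if "x \<in> set_pmf (pair_marginal P \<pi> k s)" for k x
    using that set_chain[OF \<pi> s] by (auto intro!: abs_reward_le set_policy[OF \<pi>])
  \<comment> \<open>The \<open>k\<close>-th pair is almost surely in the support of its law, hence
    consists of a state in \<open>S\<close> and a legal joint action.\<close>
  have AE: "AE \<omega> in ?T. \<bar>?f (\<omega> k)\<bar> \<le> reward_bound" for k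
  proof -
    have "AE x in distr ?T (count_space UNIV) (\<lambda>\<omega>. \<omega> k). \<bar>?f x\<bar> \<le> reward_bound"
      unfolding distr_trajectory_coordinate AE_measure_pmf_iff using bound by blast
    then show ?thesis
      by (rule AE_distrD[OF measurable_trajectory_coordinate])
  qed
  have "value_function P r \<gamma> \<pi> s = (\<Sum>k. \<gamma> ^ k * (\<integral>\<omega>. ?f (\<omega> k) \<partial>?T))"
    unfolding value_function_def
    by (rule integral_suminf_discounted[OF prob_space_trajectory_measure _ AE])
      (rule measurable_compose[OF measurable_trajectory_coordinate], simp)
  moreover have "(\<integral>\<omega>. ?f (\<omega> k) \<partial>?T) =
      measure_pmf.expectation (chain_pmf (state_kernel P \<pi>) k s) (expected_reward \<pi>)" for k
  proof -
    have "(\<integral>\<omega>. ?f (\<omega> k) \<partial>?T) = measure_pmf.expectation (pair_marginal P \<pi> k s) ?f"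
      unfolding distr_trajectory_coordinate[symmetric]
      by (rule integral_distr[symmetric, OF measurable_trajectory_coordinate]) simp
    also have "\<dots> = measure_pmf.expectation (chain_pmf (state_kernel P \<pi>) k s)
        (\<lambda>x. measure_pmf.expectation (map_pmf (Pair x) (\<pi> x)) ?f)"
      by (rule expectation_bind_pmf_bounded[OF bound])
    also have "\<dots> = measure_pmf.expectation (chain_pmf (state_kernel P \<pi>) k s) (expected_reward \<pi>)"
      by (simp add: expected_reward_def[abs_def])
    finally show ?thesis .
  qed
  ultimately show ?thesis
    by simp
qed

lemma abs_expectation_chain_le:
  fixes V :: "'s \<Rightarrow> real"
  assumes "joint_policy N S A \<pi>" "s \<in> S" "\<And>x. x \<in> S \<Longrightarrow> \<bar>V x\<bar> \<le> B"
  shows "\<bar>measure_pmf.expectation (chain_pmf (state_kernel P \<pi>) k s) V\<bar> \<le> B"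
  by (intro abs_expectation_pmf_le assms(3) set_chain[OF assms(1,2)])

lemma value_function_bounded:
  assumes \<pi>: "joint_policy N S A \<pi>" and s: "s \<in> S"
  shows "\<bar>value_function P r \<gamma> \<pi> s\<bar> \<le> (\<Sum>k. \<gamma> ^ k * reward_bound)"
proof -
  let ?x = "\<lambda>k. measure_pmf.expectation (chain_pmf (state_kernel P \<pi>) k s) (expected_reward \<pi>)"
  have x: "\<bar>?x k\<bar> \<le> reward_bound" for k
    using abs_expectation_chain_le[OF \<pi> s] abs_expected_reward_le[OF \<pi>] by blast
  have "norm (\<Sum>k. \<gamma> ^ k * ?x k) \<le> (\<Sum>k. \<gamma> ^ k * reward_bound)"
    by (rule norm_suminf_le[OF _ summable_discounted], unfold real_norm_def abs_discounted)
      (rule mult_left_mono[OF x zero_le_power[OF discount(1)]])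
  then show ?thesis
    by (simp add: value_function_eq_suminf[OF \<pi> s])
qed

lemma expectation_action_value:
  assumes \<pi>: "joint_policy N S A \<pi>" and s: "s \<in> S" and V: "\<And>x. x \<in> S \<Longrightarrow> \<bar>V x\<bar> \<le> B"
  shows "measure_pmf.expectation (\<pi> s) (action_value V s) =
    expected_reward \<pi> s + \<gamma> * measure_pmf.expectation (state_kernel P \<pi> s) V"
proof -
  have "integrable (measure_pmf (\<pi> s)) (r s)"
    using abs_reward_le[OF s set_policy[OF \<pi> s]] by (rule integrable_pmf_bounded)
  moreover have "integrable (measure_pmf (\<pi> s)) (\<lambda>a. measure_pmf.expectation (P s a) V)"
    using V[OF subsetD[OF transition[OF s set_policy[OF \<pi> s]]]]
    by (intro integrable_pmf_bounded[where B = B] abs_expectation_pmf_le)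
  moreover have "measure_pmf.expectation (state_kernel P \<pi> s) V =
      measure_pmf.expectation (\<pi> s) (\<lambda>a. measure_pmf.expectation (P s a) V)"
    by (rule expectation_bind_pmf_bounded[OF V[OF subsetD[OF set_state_kernel[OF \<pi> s]]]])
  ultimately show ?thesis
    by (simp add: action_value_def[abs_def] expected_reward_def)
qed

text \<open>Split off the reward at time 0, take one factor \<open>\<gamma>\<close> out of the tail,
  condition on the first transition, and exchange sum and expectation to recognise the value of the
  next state.\<close>

lemma value_function_Bellman:
  assumes \<pi>: "joint_policy N S A \<pi>" and s: "s \<in> S"
  shows "measure_pmf.expectation (\<pi> s) (action_value (value_function P r \<gamma> \<pi>) s) =
    value_function P r \<gamma> \<pi> s"
proof -
  let ?x = "\<lambda>k s. measure_pmf.expectation (chain_pmf (state_kernel P \<pi>) k s) (expected_reward \<pi>)"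
  have x: "\<bar>?x k s\<bar> \<le> reward_bound" if "s \<in> S" for k s
    using abs_expectation_chain_le[OF \<pi> that] abs_expected_reward_le[OF \<pi>] by blast
  have "value_function P r \<gamma> \<pi> s = (\<Sum>k. \<gamma> ^ k * ?x k s)"
    by (rule value_function_eq_suminf[OF \<pi> s])
  also have "\<dots> = ?x 0 s + (\<Sum>k. \<gamma> ^ Suc k * ?x (Suc k) s)"
    using suminf_split_head[OF summable_discounted_bounded[of "\<lambda>k. ?x k s", OF x[OF s]]]
    by (simp del: chain_pmf.simps(2))
  also have "(\<Sum>k. \<gamma> ^ Suc k * ?x (Suc k) s) = \<gamma> * (\<Sum>k. \<gamma> ^ k * ?x (Suc k) s)"
    using suminf_mult[OF summable_discounted_bounded[of "\<lambda>k. ?x (Suc k) s", OF x[OF s]]]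
    by (simp only: power_Suc mult.assoc)
  also have "(\<Sum>k. \<gamma> ^ k * ?x (Suc k) s) =
      (\<Sum>k. \<gamma> ^ k * measure_pmf.expectation (state_kernel P \<pi> s) (?x k))"
  proof -
    have "?x (Suc k) s = measure_pmf.expectation (state_kernel P \<pi> s) (?x k)" for k
      unfolding chain_pmf_Suc_left
    proof (intro expectation_bind_pmf_bounded[where B = reward_bound] abs_expected_reward_le \<pi>)
      fix x assume "x \<in> set_pmf (bind_pmf (state_kernel P \<pi> s) (chain_pmf (state_kernel P \<pi>) k))"
      then show "x \<in> S"
        using set_chain[OF \<pi> s, of x "Suc k"] by (simp only: chain_pmf_Suc_left)
    qed
    then show ?thesis
      by (simp del: chain_pmf.simps)
  qed
  also have "\<dots> = measure_pmf.expectation (state_kernel P \<pi> s) (\<lambda>s. \<Sum>k. \<gamma> ^ k * ?x k s)"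
    using x set_state_kernel[OF \<pi> s]
    by (intro integral_suminf_discounted[symmetric, where B = reward_bound]
        measure_pmf.prob_space_axioms) (simp, unfold AE_measure_pmf_iff, blast)
  also have "\<dots> = measure_pmf.expectation (state_kernel P \<pi> s) (value_function P r \<gamma> \<pi>)"
    using set_state_kernel[OF \<pi> s]
    by (intro integral_pmf_cong) (auto simp: value_function_eq_suminf[OF \<pi>] simp del: set_bind_pmf)
  finally show ?thesis
    using expectation_action_value[OF \<pi> s value_function_bounded[OF \<pi>]] by simp
qed

text \<open>
  A bounded solution \<open>V\<close> of the Bellman equation satisfies \<open>E[\<rho>(s\<^sub>k)] = E[V(s\<^sub>k)] - \<gamma> E[V(s\<^sub>k\<^sub>+\<^sub>1)]\<close>,
  where \<open>\<rho>\<close> is the expected reward, so the discounted sum telescopes.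
\<close>
lemma value_function_eqI:
  assumes \<pi>: "joint_policy N S A \<pi>" and V: "\<And>x. x \<in> S \<Longrightarrow> \<bar>V x\<bar> \<le> B"
    and Bellman: "\<And>x. x \<in> S \<Longrightarrow> measure_pmf.expectation (\<pi> x) (action_value V x) = V x"
    and s: "s \<in> S"
  shows "value_function P r \<gamma> \<pi> s = V s"
proof -
  let ?E = "\<lambda>k. measure_pmf.expectation (chain_pmf (state_kernel P \<pi>) k s)"
  \<comment> \<open>The telescoping quantity: the discounted expected value of \<open>V\<close>
    after \<open>k\<close> steps.\<close>
  define w where "w k = \<gamma> ^ k * ?E k V" for k
  have bound: "\<bar>?E k V\<bar> \<le> B" for k
    using abs_expectation_chain_le[OF \<pi> s] V by blast
  have "\<gamma> ^ k * ?E k (expected_reward \<pi>) = w k - w (Suc k)" for k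
  proof -
    let ?q = "chain_pmf (state_kernel P \<pi>) k s"
    have "?E (Suc k) V =
        measure_pmf.expectation ?q (\<lambda>x. measure_pmf.expectation (state_kernel P \<pi> x) V)"
      unfolding chain_pmf.simps
      by (rule expectation_bind_pmf_bounded, rule V, rule set_chain[OF \<pi> s, of _ "Suc k"])
        (simp only: chain_pmf.simps)
    then have "?E k (expected_reward \<pi>) + \<gamma> * ?E (Suc k) V = measure_pmf.expectation ?q
        (\<lambda>x. expected_reward \<pi> x + \<gamma> * measure_pmf.expectation (state_kernel P \<pi> x) V)"
    proof -
      have "integrable ?q (expected_reward \<pi>)"
        by (rule integrable_pmf_bounded, rule abs_expected_reward_le[OF \<pi> set_chain[OF \<pi> s]])
      moreover have "integrable ?q (\<lambda>x. measure_pmf.expectation (state_kernel P \<pi> x) V)"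
      proof (intro integrable_pmf_bounded[where B = B] abs_expectation_pmf_le V)
        fix x y assume "x \<in> set_pmf ?q" "y \<in> set_pmf (state_kernel P \<pi> x)"
        then show "y \<in> S"
          using set_chain[OF \<pi> s] set_state_kernel[OF \<pi>] by blast
      qed
      ultimately show ?thesis
        using \<open>?E (Suc k) V = _\<close> by (simp del: chain_pmf.simps)
    qed
    also have "\<dots> = ?E k V"
    proof (rule integral_pmf_cong)
      fix x assume "x \<in> set_pmf ?q"
      then have "x \<in> S"
        by (rule set_chain[OF \<pi> s])
      from expectation_action_value[OF \<pi> this V] Bellman[OF this]
      show "expected_reward \<pi> x + \<gamma> * measure_pmf.expectation (state_kernel P \<pi> x) V = V x"
        by simp
    qed
    finally have "\<gamma> ^ k * ?E k V = \<gamma> ^ k * (?E k (expected_reward \<pi>) + \<gamma> * ?E (Suc k) V)"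
      by simp
    then show ?thesis
      by (simp add: w_def algebra_simps del: chain_pmf.simps)
  qed
  \<comment> \<open>Since the expectations of \<open>V\<close> are bounded, \<open>w\<close> is the
    term of a convergent series and tends to 0. What remains of the telescoping sum is
    \<open>w 0 = V s\<close>.\<close>
  moreover have "w \<longlonglongrightarrow> 0"
    using summable_LIMSEQ_zero[OF summable_discounted_bounded[OF bound]] by (simp add: w_def[abs_def])
  then have "(\<lambda>k. w k - w (Suc k)) sums (w 0 - 0)"
    by (rule telescope_sums')
  ultimately have "(\<lambda>k. \<gamma> ^ k * ?E k (expected_reward \<pi>)) sums V s"
    by (simp add: w_def)
  then show ?thesis
    by (simp add: value_function_eq_suminf[OF \<pi> s] sums_iff)
qed

section \<open>Replacing the policy by product distributions, state by state\<close>

lemma exists_product_pmf_action_value: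
  assumes \<pi>: "joint_policy N S A \<pi>" and s: "s \<in> S" and V: "\<And>x. x \<in> S \<Longrightarrow> \<bar>V x\<bar> \<le> B"
  shows "\<exists>p. (\<forall>i\<in>agents N. set_pmf (p i) \<subseteq> A i) \<and>
    measure_pmf.expectation (Pi_pmf (agents N) undefined p) (action_value V s) =
    measure_pmf.expectation (\<pi> s) (action_value V s)"
proof -
  have bound: "\<bar>action_value V s a\<bar> \<le> reward_bound + \<gamma> * B" if "a \<in> set_pmf (\<pi> s)" for a
  proof -
    have a: "a \<in> joint_actions N A"
      using that by (rule set_policy[OF \<pi> s])
    have "\<bar>measure_pmf.expectation (P s a) V\<bar> \<le> B"
      by (rule abs_expectation_pmf_le, rule V, rule subsetD[OF transition[OF s a]])
    then have "\<bar>\<gamma> * measure_pmf.expectation (P s a) V\<bar> \<le> \<gamma> * B"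
      unfolding abs_discounted[of 1, unfolded power_one_right]
      using discount(1) by (rule mult_left_mono)
    with abs_reward_le[OF s a] show ?thesis
      unfolding action_value_def by (rule order_trans[OF abs_triangle_ineq add_mono])
  qed
  \<comment> \<open>Both endpoints of the interpolation are taken from the support of
    \<open>\<pi> s\<close>, so they are legal joint actions and every coordinate mixture stays
    inside \<open>A i\<close>.\<close>
  obtain a where a: "a \<in> set_pmf (\<pi> s)"
    and "action_value V s a \<le> measure_pmf.expectation (\<pi> s) (action_value V s)"
    using exists_le_expectation_pmf[of "\<pi> s" "action_value V s", OF bound] ..
  moreover obtain b where b: "b \<in> set_pmf (\<pi> s)"
    and "measure_pmf.expectation (\<pi> s) (action_value V s) \<le> action_value V s b"
    using exists_ge_expectation_pmf[of "\<pi> s" "action_value V s", OF bound] ..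
  ultimately show ?thesis
    using set_policy[OF \<pi> s a] set_policy[OF \<pi> s b] unfolding joint_actions_def
    by (intro exists_Pi_pmf_expectation_eq finite_agents)
qed

text \<open>The default \<open>undefined\<close> makes every sampled function extensional on the
  agents, so the support lies in the extensional product and \<open>pmf_Pi'\<close> gives the
  product formula there.\<close>

lemma independent_policy_Pi_pmf:
  assumes "\<And>s i. s \<in> S \<Longrightarrow> i \<in> agents N \<Longrightarrow> set_pmf (p s i) \<subseteq> A i"
  shows "independent_policy N S A (\<lambda>s. Pi_pmf (agents N) undefined (p s))"
proof -
  have "set_pmf (Pi_pmf (agents N) undefined (p s)) \<subseteq> joint_actions N A" if "s \<in> S" for s
    using set_Pi_pmf_subset'[OF finite_agents, of undefined "p s"] assms[OF that]
    unfolding PiE_dflt_def joint_actions_def PiE_def Pi_def extensional_def comp_def by blast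
  moreover have "pmf (Pi_pmf (agents N) undefined (p s)) a = (\<Prod>i\<in>agents N. pmf (p s i) (a i))"
    if "a \<in> joint_actions N A" for s a
    using that by (intro pmf_Pi' finite_agents) (auto simp: joint_actions_def PiE_iff extensional_def)
  ultimately show ?thesis
    unfolding independent_policy_def joint_policy_def individual_policy_def
    \<comment> \<open>The factors were chosen state by state, whereas the definition takes the agent
      first; hence the swapped arguments.\<close>
    by (intro conjI exI[of _ "\<lambda>i s. p s i"] ballI assms)
qed

lemma exists_independent_policy_value_function_eq:
  assumes \<pi>: "joint_policy N S A \<pi>"
  shows "\<exists>\<pi>'. independent_policy N S A \<pi>' \<and>
    (\<forall>s\<in>S. value_function P r \<gamma> \<pi> s = value_function P r \<gamma> \<pi>' s)"
proof -
  let ?V = "value_function P r \<gamma> \<pi>"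
  note bounded = value_function_bounded[OF \<pi>]
  have "\<forall>s\<in>S. \<exists>p. (\<forall>i\<in>agents N. set_pmf (p i) \<subseteq> A i) \<and>
      measure_pmf.expectation (Pi_pmf (agents N) undefined p) (action_value ?V s) = ?V s"
    using exists_product_pmf_action_value[OF \<pi>, where V = ?V, OF _ bounded]
      value_function_Bellman[OF \<pi>] by simp
  \<comment> \<open>The axiom of choice picks the product distributions in all states at
    once.\<close>
  then obtain p where p: "\<And>s i. s \<in> S \<Longrightarrow> i \<in> agents N \<Longrightarrow> set_pmf (p s i) \<subseteq> A i"
    and Bellman: "\<And>s. s \<in> S \<Longrightarrow>
      measure_pmf.expectation (Pi_pmf (agents N) undefined (p s)) (action_value ?V s) = ?V s"
    unfolding bchoice_iff by blast
  let ?\<pi>' = "\<lambda>s. Pi_pmf (agents N) undefined (p s)"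
  have ind: "independent_policy N S A ?\<pi>'"
    using p by (rule independent_policy_Pi_pmf)
  then have "joint_policy N S A ?\<pi>'"
    by (simp add: independent_policy_def)
  then have "value_function P r \<gamma> ?\<pi>' s = ?V s" if "s \<in> S" for s
    using bounded Bellman that by (rule value_function_eqI)
  then show ?thesis
    using ind by (intro exI[of _ ?\<pi>']) simp
qed

end

theorem theorem2:
  fixes N :: nat
    and S :: "'s set"
    and A :: "nat \<Rightarrow> 'a set"
    and P :: "'s \<Rightarrow> (nat \<Rightarrow> 'a) \<Rightarrow> 's pmf"
    and r :: "'s \<Rightarrow> (nat \<Rightarrow> 'a) \<Rightarrow> real"
    and \<gamma> :: real
    and \<pi>_dep :: "'s \<Rightarrow> (nat \<Rightarrow> 'a) pmf"
  assumes "multi_agent_MDP N S A P r \<gamma>"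
    and "dependent_policy N S A \<pi>_dep"
  shows "\<exists>\<pi>_ind. independent_policy N S A \<pi>_ind \<and>
           (\<forall>s\<in>S. value_function P r \<gamma> \<pi>_dep s = value_function P r \<gamma> \<pi>_ind s)"
  using assms multi_agent_MDP.exists_independent_policy_value_function_eq
  unfolding dependent_policy_def by blast

end
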